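(* For any integers $d\ge 2$ and $n\ge 1$, $$\{\mathcal X \mid \operatorname{rank}_{CP}(\mathcal X)=1,\ \mathcal X\in\mathbb S^{n^d}\}=\{\mathcal X\mid \operatorname{rank}(\mathrm{Mat}(\mathcal X))=1,\ \mathcal X\in\mathbb S^{n^d}\}.$$
   Context: All tensors are real. $\mathbb R^{n^d}$ denotes the space of $d$-th order tensors $\mathcal X=(\mathcal X_{i_1\cdots i_d})$ with each index in $\{1,\dots,n\}$, and $\mathbb S^{n^d}$ is the subspace of symmetric tensors (entries invariant under every permutation of the indices). $\mathrm{Mat}(\mathcal X)\in\mathbb R^{n^{\lfloor d/2\rfloor}\times n^{\lceil d/2\rceil}}$ is the reshaping of $\mathcal X$ (as in Matlab's reshape) whose rows are indexed by $(i_1,\dots,i_{\lfloor d/2\rfloor})$ and whose columns are indexed by $(i_{\lfloor d/2\rfloor+1},\dots,i_d)$. A rank-1 tensor is a nonzero outer product $\mathbf a_1\circ\cdots\circ\mathbf a_d$ with $\mathbf a_i\in\mathbb R^n$, i.e. $(\mathbf a_1\circ\cdots\circ\mathbf a_d)_{j_1\cdots j_d}=(\mathbf a_1)_{j_1}\cdots(\mathbf a_d)_{j_d}$. $\operatorname{rank}_{CP}(\mathcal X)$ is the smallest number of rank-1 tensors whose sum is $\mathcal X$; $\operatorname{rank}_{CP}(\mathcal X)=1$ means that $\mathcal X$ is a rank-1 tensor. *)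

theory Defs
  imports
    "HOL-Combinatorics.Permutations"
    "Jordan_Normal_Form.DL_Rank"
begin

text \<open>
  Indices and positions are counted from 0, as in the matrix library, so a multi-index of order
  \<open>d\<close> is a list of length \<open>d\<close> with entries in \<open>{..<n}\<close>.  A tensor is a
  function on lists that is 0 away from the multi-indices; this makes equality of functions
  equality of tensors and lets sums be taken entrywise.
\<close>

type_synonym tensor = "nat list \<Rightarrow> real"

definition multi_indices :: "nat \<Rightarrow> nat \<Rightarrow> nat list set" where
  "multi_indices n d = {is. length is = d \<and> set is \<subseteq> {..<n}}"

definition tensors :: "nat \<Rightarrow> nat \<Rightarrow> tensor set" where
  "tensors n d = {X. \<forall>is. is \<notin> multi_indices n d \<longrightarrow> X is = 0}"

definition sym_tensors :: "nat \<Rightarrow> nat \<Rightarrow> tensor set" where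
  "sym_tensors n d = {X \<in> tensors n d.
     \<forall>is \<in> multi_indices n d. \<forall>\<sigma>. \<sigma> permutes {..<d} \<longrightarrow> X (permute_list \<sigma> is) = X is}"

definition outer_product :: "nat \<Rightarrow> nat \<Rightarrow> (nat \<Rightarrow> real vec) \<Rightarrow> tensor" where
  "outer_product n d a =
     (\<lambda>is. if is \<in> multi_indices n d then \<Prod>k<d. a k $ (is ! k) else 0)"

definition rank_one_tensor :: "nat \<Rightarrow> nat \<Rightarrow> tensor \<Rightarrow> bool" where
  "rank_one_tensor n d X \<longleftrightarrow>
     (\<exists>a. (\<forall>k<d. a k \<in> carrier_vec n) \<and> X = outer_product n d a) \<and> X \<noteq> (\<lambda>_. 0)"

text \<open>
  For \<open>d \<ge> 1\<close> every element of \<open>tensors n d\<close> is a sum of finitely many rank-1 tensors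
  (one for each nonzero entry), so the minimum below exists; the empty sum gives the zero
  tensor rank 0.
\<close>

definition rank_CP :: "nat \<Rightarrow> nat \<Rightarrow> tensor \<Rightarrow> nat" where
  "rank_CP n d X =
     (LEAST r. \<exists>T. (\<forall>k<r. rank_one_tensor n d (T k)) \<and> X = (\<lambda>is. \<Sum>k<r. T k is))"

text \<open>
  Reshaping is column-major: in the linear index of a multi-index the first component varies
  fastest, so that \<open>unflatten n k\<close> inverts \<open>is \<mapsto> (\<Sum>j<k. is ! j * n ^ j)\<close>.
\<close>

definition unflatten :: "nat \<Rightarrow> nat \<Rightarrow> nat \<Rightarrow> nat list" where
  "unflatten n k r = map (\<lambda>j. r div n ^ j mod n) [0..<k]"

definition Mat :: "nat \<Rightarrow> nat \<Rightarrow> tensor \<Rightarrow> real mat" where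
  "Mat n d X = mat (n ^ (d div 2)) (n ^ (d - d div 2))
     (\<lambda>(r, c). X (unflatten n (d div 2) r @ unflatten n (d - d div 2) c))"

text \<open>The first argument of \<open>vec_space.rank\<close> is the number of rows.\<close>

abbreviation mat_rank :: "real mat \<Rightarrow> nat" where
  "mat_rank A \<equiv> vec_space.rank (dim_row A) A"

end

theory Submission
  imports Defs
begin

text \<open>
  The matricization has rank 1 iff \<open>X\<close> is nonzero and \<open>X (is @ js) = u is * v js\<close>; an outer product
  clearly splits in this way.  Conversely, symmetry moves a single index across the cut, so that
  \<open>u (c # i) * v (e # j) = u (e # i) * v (c # j)\<close>.  Applying this to two products of entries shows that
  \<open>X x * X y\<close> is unchanged when \<open>x\<close> and \<open>y\<close> exchange their entries at one position.  Starting from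
  \<open>s\<close> with \<open>X s \<noteq> 0\<close>, the entries of \<open>s\<close> can therefore be replaced by those of \<open>x\<close> one at a time,
  each at the cost of a factor \<open>X (s[k := x ! k]) / X s\<close>, and these factors form an outer product.
\<close>

section \<open>Matrices of rank 1\<close>

lemma (in vec_space) lin_dep_index_sum:
  assumes "finite S" "S \<subseteq> carrier_vec n" "lin_dep S"
  shows "\<exists>a. (\<exists>w\<in>S. a w \<noteq> 0) \<and> (\<forall>i<n. (\<Sum>x\<in>S. a x * x $ i) = 0)"
proof -
  obtain a w where aw: "w \<in> S" "a w \<noteq> 0" and zero: "lincomb a S = 0\<^sub>v n"
    using finite_lin_dep[OF assms(1) assms(3)] assms(2) by auto
  have "(\<Sum>x\<in>S. a x * x $ i) = 0" if "i < n" for i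
    using lincomb_index[OF that assms(2), of a] zero that by simp
  with aw show ?thesis by blast
qed

text \<open>With a nonzero entry at \<open>(r, c)\<close> as pivot, rank 1 makes every 2x2 minor
  containing the pivot vanish, so column \<open>c\<close> and the row \<open>r\<close> divided by
  the pivot are the two factors. Conversely, the product form bounds the rank by 1 from above, and
  the column of a nonzero entry is an independent set, which bounds it from below.\<close>

lemma (in vec_space) rank_eq_1_iff_product_entries:
  assumes A: "A \<in> carrier_mat n nc"
  shows "rank A = 1 \<longleftrightarrow>
    (\<exists>u v. \<forall>i<n. \<forall>j<nc. A $$ (i, j) = u i * v j) \<and> (\<exists>i<n. \<exists>j<nc. A $$ (i, j) \<noteq> 0)"
proof
  assume rank: "rank A = 1"
  have "A \<noteq> 0\<^sub>m n nc"
    using rank rank_0I[of nc] by auto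
  then obtain r c where rc: "r < n" "c < nc" "A $$ (r, c) \<noteq> 0"
    using A by (metis eq_matI carrier_matD index_zero_mat)
  have minor: "A $$ (i, j) * A $$ (r, c) = A $$ (i, c) * A $$ (r, j)"
    if ij: "i < n" "j < nc" for i j
  \<comment> \<open>Equal columns collapse to a one-element set, whose dependence does not follow
    from rank 1; they are treated apart.\<close>
  proof (cases "col A j = col A c")
    case True
    have "A $$ (i, j) = A $$ (i, c)" "A $$ (r, j) = A $$ (r, c)"
      using True A ij rc by (metis carrier_matD index_col)+
    then show ?thesis by simp
  next
    case False
    let ?U = "{col A j, col A c}"
    have sub: "?U \<subseteq> set (cols A)"
      using A ij rc by (auto simp: cols_def)
    have "?U \<subseteq> carrier_vec n"
      using A by auto
    moreover have "lin_dep ?U"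
      using rank_ge_card_indpt[OF A sub] rank False by auto
    ultimately obtain a w where aw: "w \<in> ?U" "a w \<noteq> 0"
      and zero: "\<And>i. i < n \<Longrightarrow> (\<Sum>x\<in>?U. a x * x $ i) = 0"
      using lin_dep_index_sum[of ?U] by blast
    have "a (col A j) * A $$ (k, j) + a (col A c) * A $$ (k, c) = 0" if "k < n" for k
      using zero[OF that] False A ij rc that by auto
    note dep = this[OF ij(1)] this[OF rc(1)]
    \<comment> \<open>As in Cramer's rule, each coefficient of the dependence times the minor
      \<open>?D\<close> is a combination of the two relations \<open>dep\<close>; since some
      coefficient is nonzero, \<open>?D\<close> vanishes.\<close>
    let ?D = "A $$ (i, j) * A $$ (r, c) - A $$ (i, c) * A $$ (r, j)"
    have "a (col A j) * ?D = (a (col A j) * A $$ (i, j) + a (col A c) * A $$ (i, c)) * A $$ (r, c)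
        - (a (col A j) * A $$ (r, j) + a (col A c) * A $$ (r, c)) * A $$ (i, c)"
      by (simp add: algebra_simps)
    moreover have "a (col A c) * ?D = (a (col A j) * A $$ (r, j) + a (col A c) * A $$ (r, c)) * A $$ (i, j)
        - (a (col A j) * A $$ (i, j) + a (col A c) * A $$ (i, c)) * A $$ (r, j)"
      by (simp add: algebra_simps)
    ultimately have "a (col A j) * ?D = 0" "a (col A c) * ?D = 0"
      by (simp_all add: dep)
    then show ?thesis using aw by auto
  qed
  have "\<forall>i<n. \<forall>j<nc. A $$ (i, j) = A $$ (i, c) * (A $$ (r, j) / A $$ (r, c))"
    using minor rc(3) by (auto simp: field_simps)
  then have "\<exists>u v. \<forall>i<n. \<forall>j<nc. A $$ (i, j) = u i * v j"
    by (intro exI[of _ "\<lambda>i. A $$ (i, c)"] exI[of _ "\<lambda>j. A $$ (r, j) / A $$ (r, c)"])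
  then show "(\<exists>u v. \<forall>i<n. \<forall>j<nc. A $$ (i, j) = u i * v j) \<and> (\<exists>i<n. \<exists>j<nc. A $$ (i, j) \<noteq> 0)"
    using rc by blast
next
  assume "(\<exists>u v. \<forall>i<n. \<forall>j<nc. A $$ (i, j) = u i * v j) \<and> (\<exists>i<n. \<exists>j<nc. A $$ (i, j) \<noteq> 0)"
  then obtain u v r c where prod: "\<And>i j. i < n \<Longrightarrow> j < nc \<Longrightarrow> A $$ (i, j) = u i * v j"
    and rc: "r < n" "c < nc" "A $$ (r, c) \<noteq> 0"
    by blast
  have "rank A \<le> 1"
    using A prod by (intro rank_le_1_product_entries[of A nc u v]) auto
  moreover have "1 \<le> rank A"
  proof -
    have "\<not> lin_dep {col A c}"
    proof
      assume dep: "lin_dep {col A c}"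
      have "{col A c} \<subseteq> carrier_vec n"
        using A by auto
      then obtain a w where "w \<in> {col A c}" "a w \<noteq> 0"
        "\<And>i. i < n \<Longrightarrow> (\<Sum>x\<in>{col A c}. a x * x $ i) = 0"
        using lin_dep_index_sum[OF _ _ dep] by blast
      then show False using rc A by force
    qed
    moreover have "{col A c} \<subseteq> set (cols A)"
      using A rc by (auto simp: cols_def)
    ultimately show ?thesis
      using rank_ge_card_indpt[OF A, of "{col A c}"] by simp
  qed
  ultimately show "rank A = 1" by simp
qed

section \<open>Multi-indices and the reshaping\<close>

lemma multi_indices_nth_less: "is \<in> multi_indices n d \<Longrightarrow> k < d \<Longrightarrow> is ! k < n"
  using nth_mem[of k "is"] unfolding multi_indices_def by blast

text \<open>Splits off the least significant digit in base \<open>n\<close>, which prepares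
  induction on the length.\<close>

lemma unflatten_Suc: "unflatten n (Suc k) r = (r mod n) # unflatten n k (r div n)"
  unfolding unflatten_def upt_conv_Cons[OF zero_less_Suc] map_Suc_upt[symmetric]
  by (simp add: div_mult2_eq)

lemma unflatten_in_multi_indices: "n > 0 \<Longrightarrow> unflatten n k r \<in> multi_indices n k"
  by (auto simp: unflatten_def multi_indices_def)

lemma unflatten_surj:
  assumes "is \<in> multi_indices n k"
  obtains r where "r < n ^ k" "unflatten n k r = is"
proof -
  have "\<exists>r < n ^ k. unflatten n k r = is"
    using assms
  proof (induction k arbitrary: "is")
    case 0
    then show ?case by (simp add: unflatten_def multi_indices_def)
  next
    case (Suc k)
    then obtain i js where is_eq: "is = i # js" and i: "i < n" and js: "js \<in> multi_indices n k"
      by (cases "is") (auto simp: multi_indices_def)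
    from Suc.IH[OF js] obtain r where r: "r < n ^ k" "unflatten n k r = js"
      by blast
    \<comment> \<open>The preimage of \<open>i # js\<close> is the Horner step
      \<open>i + n * r\<close>.\<close>
    have "i + n * r < n * Suc r"
      using i by simp
    also have "\<dots> \<le> n * n ^ k"
      using r(1) by (intro mult_le_mono2) simp
    finally have "i + n * r < n ^ Suc k" by simp
    moreover have "unflatten n (Suc k) (i + n * r) = is"
      using i r by (simp add: unflatten_Suc is_eq)
    ultimately show ?case by blast
  qed
  then show thesis using that by blast
qed

text \<open>Relabels \<open>rank_eq_1_iff_product_entries\<close>: composing with
  \<open>unflatten\<close> carries factors from multi-indices to row and column numbers, and a right
  inverse of \<open>unflatten\<close> carries them back.\<close>

lemma Mat_rank_eq_1_iff:
  assumes "n > 0" and X: "X \<in> tensors n d"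
  defines "p \<equiv> d div 2" and "q \<equiv> d - d div 2"
  shows "mat_rank (Mat n d X) = 1 \<longleftrightarrow>
    (\<exists>u v. \<forall>is\<in>multi_indices n p. \<forall>js\<in>multi_indices n q. X (is @ js) = u is * v js) \<and>
    X \<noteq> (\<lambda>_. 0)"
proof -
  let ?A = "Mat n d X"
  have carr: "?A \<in> carrier_mat (n ^ p) (n ^ q)" and dim: "dim_row ?A = n ^ p"
    by (simp_all add: Mat_def p_def q_def)
  have entry: "?A $$ (r, c) = X (unflatten n p r @ unflatten n q c)"
    if "r < n ^ p" "c < n ^ q" for r c
    using that by (simp add: Mat_def p_def q_def)
  have pq: "p + q = d"
    by (simp add: p_def q_def)
  have "(\<exists>u v. \<forall>r<n ^ p. \<forall>c<n ^ q. ?A $$ (r, c) = u r * v c) \<longleftrightarrow>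
    (\<exists>u v. \<forall>is\<in>multi_indices n p. \<forall>js\<in>multi_indices n q. X (is @ js) = u is * v js)"
    (is "?L \<longleftrightarrow> ?R")
  proof
    assume ?L
    then obtain u v where uv: "\<And>r c. r < n ^ p \<Longrightarrow> c < n ^ q \<Longrightarrow>
        X (unflatten n p r @ unflatten n q c) = u r * v c"
      using entry by metis
    \<comment> \<open>\<open>f k\<close> chooses a linear index for each multi-index of length
      \<open>k\<close>.\<close>
    define f where "f k is = (SOME r. r < n ^ k \<and> unflatten n k r = is)" for k "is"
    have f: "f k is < n ^ k \<and> unflatten n k (f k is) = is" if "is \<in> multi_indices n k" for k "is"
      unfolding f_def by (rule someI_ex) (use unflatten_surj[OF that] in blast)
    have "X (is @ js) = u (f p is) * v (f q js)"
      if "is \<in> multi_indices n p" "js \<in> multi_indices n q" for "is" js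
      using uv[of "f p is" "f q js"] f[OF that(1)] f[OF that(2)] by simp
    then show ?R
      by (intro exI[of _ "\<lambda>is. u (f p is)"] exI[of _ "\<lambda>js. v (f q js)"]) blast
  next
    assume ?R
    then obtain u v where uv: "\<And>is js. is \<in> multi_indices n p \<Longrightarrow> js \<in> multi_indices n q \<Longrightarrow>
        X (is @ js) = u is * v js"
      by blast
    then have "\<forall>r<n ^ p. \<forall>c<n ^ q. ?A $$ (r, c) = u (unflatten n p r) * v (unflatten n q c)"
      using entry unflatten_in_multi_indices[OF assms(1)] by simp
    then show ?L
      by (intro exI[of _ "\<lambda>r. u (unflatten n p r)"] exI[of _ "\<lambda>c. v (unflatten n q c)"])
  qed
  moreover have "(\<exists>r<n ^ p. \<exists>c<n ^ q. ?A $$ (r, c) \<noteq> 0) \<longleftrightarrow> X \<noteq> (\<lambda>_. 0)"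
  proof
    assume "X \<noteq> (\<lambda>_. 0)"
    \<comment> \<open>A nonzero value can only sit at a multi-index; cutting that at
      \<open>p\<close> gives the row and the column of a nonzero matrix entry.\<close>
    then obtain s where s: "X s \<noteq> 0" by auto
    with X have "s \<in> multi_indices n d"
      by (auto simp: tensors_def)
    then have "take p s \<in> multi_indices n p" "drop p s \<in> multi_indices n q"
      using pq by (auto simp: multi_indices_def dest: in_set_takeD in_set_dropD)
    then obtain r c where "r < n ^ p" "unflatten n p r = take p s"
      "c < n ^ q" "unflatten n q c = drop p s"
      by (metis unflatten_surj)
    then show "\<exists>r<n ^ p. \<exists>c<n ^ q. ?A $$ (r, c) \<noteq> 0"
      using s entry by (metis append_take_drop_id)
  qed (use entry in auto)
  ultimately show ?thesis
    unfolding dim vec_space.rank_eq_1_iff_product_entries[OF carr] by simp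
qed

section \<open>CP rank 1 and rank-1 tensors\<close>

lemma rank_one_tensor_single_entry:
  assumes s: "s \<in> multi_indices n d" and "c \<noteq> 0" "d > 0"
  shows "rank_one_tensor n d (\<lambda>is. if is = s then c else 0)"
proof -
  \<comment> \<open>Unit vectors selecting the entries of \<open>s\<close>; the scalar
    \<open>c\<close> is put into factor 0, which exists because \<open>d > 0\<close>.\<close>
  define a where "a k = vec n (\<lambda>j. if j = s ! k then if k = 0 then c else 1 else 0)" for k
  have "(\<Prod>k<d. a k $ (is ! k)) = (if is = s then c else 0)" if "is": "is \<in> multi_indices n d" for "is"
  proof -
    note lt = multi_indices_nth_less[OF "is"]
    show ?thesis
    proof (cases "is = s")
      case True
      have "(\<Prod>k<d. a k $ (is ! k)) = (\<Prod>k<d. if k = 0 then c else 1)"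
        using lt True by (intro prod.cong) (auto simp: a_def)
      then show ?thesis using True \<open>d > 0\<close> by simp
    next
      case False
      then obtain k where "k < d" "is ! k \<noteq> s ! k"
        using s "is" nth_equalityI[of "is" s] by (auto simp: multi_indices_def)
      then have "\<exists>k\<in>{..<d}. a k $ (is ! k) = 0"
        using lt by (intro bexI[of _ k]) (auto simp: a_def)
      then show ?thesis using False by (simp add: prod_zero)
    qed
  qed
  then have "(\<lambda>is. if is = s then c else 0) = outer_product n d a"
    using s by (auto simp: outer_product_def)
  moreover have "(\<lambda>is. if is = s then c else 0) \<noteq> (\<lambda>_. 0)"
    using \<open>c \<noteq> 0\<close> by metis
  moreover have "\<forall>k<d. a k \<in> carrier_vec n"
    by (simp add: a_def)
  ultimately show ?thesis
    unfolding rank_one_tensor_def by blast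
qed

text \<open>\<open>rank_CP\<close> is a \<open>LEAST\<close>, which is known to be attained only
  once some decomposition exists. The sum of the single nonzero entries is one.\<close>

lemma rank_one_decomposition_exists:
  assumes X: "X \<in> tensors n d" and "d > 0"
  shows "\<exists>(r::nat) T. (\<forall>k<r. rank_one_tensor n d (T k)) \<and> X = (\<lambda>is. \<Sum>k<r. T k is)"
proof -
  define S where "S = {is. X is \<noteq> 0}"
  have sub: "S \<subseteq> multi_indices n d"
    using X by (auto simp: S_def tensors_def)
  have "finite (multi_indices n d)"
    using finite_lists_length_eq[of "{..<n}" d] by (simp add: multi_indices_def conj_commute)
  with sub have fin: "finite S"
    by (rule finite_subset)
  then obtain h where h: "bij_betw h {..<card S} S"
    using ex_bij_betw_nat_finite by (metis atLeast0LessThan)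
  define T where "T k = (\<lambda>is. if is = h k then X (h k) else 0)" for k
  have "rank_one_tensor n d (T k)" if "k < card S" for k
  proof -
    have "h k \<in> S" using h that by (auto simp: bij_betw_def)
    then show ?thesis
      unfolding T_def using sub \<open>d > 0\<close>
      by (intro rank_one_tensor_single_entry) (auto simp: S_def)
  qed
  moreover have "(\<Sum>k<card S. T k is) = X is" for "is"
  proof -
    have "(\<Sum>k<card S. T k is) = (\<Sum>j\<in>S. if is = j then X j else 0)"
      unfolding T_def by (rule sum.reindex_bij_betw[OF h])
    also have "\<dots> = X is"
      using fin by (simp add: S_def)
    finally show ?thesis .
  qed
  ultimately have "(\<forall>k<card S. rank_one_tensor n d (T k)) \<and> X = (\<lambda>is. \<Sum>k<card S. T k is)"
    by simp
  then show ?thesis by (intro exI[of _ "card S"] exI[of _ T])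
qed

text \<open>The minimum is attained, so the value 1 yields a decomposition with one term.
  Conversely, a rank-1 tensor is nonzero and hence not the empty sum.\<close>

lemma rank_CP_eq_1_iff:
  assumes "X \<in> tensors n d" and "d > 0"
  shows "rank_CP n d X = 1 \<longleftrightarrow> rank_one_tensor n d X"
proof -
  define P where "P r \<longleftrightarrow> (\<exists>T. (\<forall>k<r. rank_one_tensor n d (T k)) \<and> X = (\<lambda>is. \<Sum>k<r. T k is))"
    for r :: nat
  have rank: "rank_CP n d X = (LEAST r. P r)"
    by (simp add: rank_CP_def P_def)
  have ex: "\<exists>r. P r"
    unfolding P_def by (rule rank_one_decomposition_exists[OF assms])
  have P0: "P 0 \<longleftrightarrow> X = (\<lambda>_. 0)"
    by (simp add: P_def)
  have P1: "P 1 \<longleftrightarrow> rank_one_tensor n d X"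
    unfolding P_def by auto
  show ?thesis
  proof
    assume "rank_CP n d X = 1"
    then show "rank_one_tensor n d X"
      using LeastI_ex[OF ex] rank P1 by metis
  next
    assume one: "rank_one_tensor n d X"
    then have "\<not> P 0"
      by (simp add: P0 rank_one_tensor_def)
    moreover have "P 1" using one P1 by simp
    ultimately show "rank_CP n d X = 1"
      unfolding rank by (intro Least_equality) (auto simp: Suc_le_eq intro: gr0I)
  qed
qed

section \<open>Symmetry and the exchange of indices\<close>

lemma sym_tensors_mset_cong:
  assumes X: "X \<in> sym_tensors n d" and eq: "mset xs = mset ys"
  shows "X xs = X ys"
proof (cases "ys \<in> multi_indices n d")
  case True
  obtain f where "f permutes {..<length ys}" "permute_list f ys = xs"
    using mset_eq_permutation[OF eq] .
  with X True show ?thesis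
    by (auto simp: sym_tensors_def multi_indices_def)
next
  case False
  \<comment> \<open>A rearrangement also lies outside \<open>multi_indices n d\<close>, so both
    values are the default 0.\<close>
  then have "xs \<notin> multi_indices n d"
    using mset_eq_length[OF eq] mset_eq_setD[OF eq] by (simp add: multi_indices_def)
  with X False show ?thesis
    by (simp add: sym_tensors_def tensors_def)
qed

text \<open>Symmetry puts \<open>a\<close> and \<open>b\<close> into the column part of both
  entries. The factor \<open>u (c # i)\<close> from \<open>x\<close> is then common to both sides:
  if it is 0, both sides vanish; otherwise it may be multiplied in a second time, and
  \<open>exch\<close> trades \<open>a\<close> and \<open>b\<close> into the row part, where the
  order of the factors no longer matters.\<close>

lemma sym_tensor_swap_head:
  assumes X: "X \<in> sym_tensors n (p + q)" and "p > 0" "q > 0"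
    and uv: "\<And>is js. is \<in> multi_indices n p \<Longrightarrow> js \<in> multi_indices n q \<Longrightarrow> X (is @ js) = u is * v js"
    and ax: "a # x \<in> multi_indices n (p + q)" and yb: "b # y \<in> multi_indices n (p + q)"
  shows "X (a # x) * X (b # y) = X (b # x) * X (a # y)"
proof -
  \<comment> \<open>Since \<open>x\<close> has length \<open>1 + (p - 1) + (q - 1)\<close>, one
    index \<open>c\<close> can be set aside as the partner in exchanges across the cut;
    \<open>i\<close> and \<open>j\<close> each leave room for one more index. The list
    \<open>y\<close> gives a full row index \<open>k\<close> and a column index \<open>l\<close>
    with one place free.\<close>
  define c where "c = hd x"
  define i where "i = take (p - 1) (tl x)"
  define j where "j = drop (p - 1) (tl x)"
  define k where "k = take p y"
  define l where "l = drop p y"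
  have x: "x = c # i @ j" and y: "y = k @ l"
    using ax \<open>p > 0\<close> \<open>q > 0\<close> by (cases x; auto simp: c_def i_def j_def k_def l_def multi_indices_def)+
  have ab: "a < n" "b < n" and c: "c < n"
    using ax yb x by (auto simp: multi_indices_def)
  have lens: "length i = p - 1" "length j = q - 1" "length k = p" "length l = q - 1"
    using ax yb \<open>p > 0\<close> \<open>q > 0\<close> by (auto simp: multi_indices_def i_def j_def k_def l_def)
  have sets: "set i \<subseteq> {..<n}" "set j \<subseteq> {..<n}" "set k \<subseteq> {..<n}" "set l \<subseteq> {..<n}"
    using ax yb unfolding x y by (simp_all add: multi_indices_def)
  have i: "e # i \<in> multi_indices n p" and j: "e # j \<in> multi_indices n q"
    and l: "e # l \<in> multi_indices n q" if "e < n" for e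
    using lens sets that \<open>p > 0\<close> \<open>q > 0\<close> by (simp_all add: multi_indices_def)
  have k: "k \<in> multi_indices n p"
    using lens sets by (simp add: multi_indices_def)
  have exch: "u (c # i) * v (e # m) = u (e # i) * v (c # m)"
    if "e < n" and m: "\<And>e. e < n \<Longrightarrow> e # m \<in> multi_indices n q" for e m
  proof -
    have "X ((c # i) @ (e # m)) = X ((e # i) @ (c # m))"
      by (rule sym_tensors_mset_cong[OF X]) simp
    then show ?thesis
      using uv[OF i m] c \<open>e < n\<close> by simp
  qed
  have exch_j: "u (c # i) * v (e # j) = u (e # i) * v (c # j)"
    and exch_l: "u (c # i) * v (e # l) = u (e # i) * v (c # l)" if "e < n" for e
    using exch[OF that] j l by blast+
  have Xx: "X (e # x) = u (c # i) * v (e # j)" if "e < n" for e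
  proof -
    have "X (e # x) = X ((c # i) @ (e # j))"
      by (rule sym_tensors_mset_cong[OF X]) (simp add: x)
    then show ?thesis using uv[OF i j] c that by simp
  qed
  have Xy: "X (e # y) = u k * v (e # l)" if "e < n" for e
  proof -
    have "X (e # y) = X (k @ (e # l))"
      by (rule sym_tensors_mset_cong[OF X]) (simp add: y)
    then show ?thesis using uv[OF k l] that by simp
  qed
  show ?thesis
  proof (cases "u (c # i) = 0")
    case True
    then show ?thesis using Xx ab by simp
  next
    case False
    \<comment> \<open>After the rewriting both sides consist of the same four factors
      \<open>u (a # i)\<close>, \<open>u (b # i)\<close>, \<open>v (c # j)\<close> and
      \<open>v (c # l)\<close>.\<close>
    have "(u (c # i) * v (a # j)) * (u (c # i) * v (b # l))
        = (u (c # i) * v (b # j)) * (u (c # i) * v (a # l))"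
      unfolding exch_j[OF ab(1)] exch_j[OF ab(2)] exch_l[OF ab(1)] exch_l[OF ab(2)]
      by (simp only: mult_ac)
    with False have "v (a # j) * v (b # l) = v (b # j) * v (a # l)"
      by simp
    then show ?thesis
      using Xx Xy ab by (simp add: mult_ac)
  qed
qed

text \<open>Exchange at every single position makes \<open>X\<close> multiplicative over positions,
  relative to a base point \<open>s\<close> where it is nonzero.\<close>

lemma rank_one_tensor_if_swap:
  assumes X: "X \<in> tensors n d" and "X \<noteq> (\<lambda>_. 0)" and "d > 0"
    and swap: "\<And>x1 a x2 y1 b y2. x1 @ a # x2 \<in> multi_indices n d \<Longrightarrow> y1 @ b # y2 \<in> multi_indices n d \<Longrightarrow>
      length x1 = length y1 \<Longrightarrow>
      X (x1 @ a # x2) * X (y1 @ b # y2) = X (x1 @ b # x2) * X (y1 @ a # y2)"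
  shows "rank_one_tensor n d X"
proof -
  obtain s where Xs: "X s \<noteq> 0"
    using assms(2) by auto
  with X have s: "s \<in> multi_indices n d"
    by (auto simp: tensors_def)
  \<comment> \<open>Induction over hybrids of \<open>x\<close> and \<open>s\<close>; at
    \<open>m = d\<close> the hybrid is \<open>x\<close> itself.\<close>
  have prefix: "X (take m x @ drop m s) = X s * (\<Prod>k<m. X (s[k := x ! k]) / X s)"
    if x: "x \<in> multi_indices n d" and "m \<le> d" for x m
    using \<open>m \<le> d\<close>
  proof (induction m)
    case 0
    then show ?case by simp
  next
    case (Suc m)
    have len: "m < length x" "m < length s"
      using x s Suc.prems by (auto simp: multi_indices_def)
    have s_eq: "take m s @ s ! m # drop (Suc m) s = s"
      using len id_take_nth_drop by metis
    have "take m x @ x ! m # drop (Suc m) s \<in> multi_indices n d"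
      using x s Suc.prems len multi_indices_nth_less[OF x, of m]
      by (auto simp: multi_indices_def dest: in_set_takeD in_set_dropD)
    \<comment> \<open>The exchange pairs the hybrid for \<open>Suc m\<close> with \<open>s\<close>:
      at position \<open>m\<close> the former falls back to the hybrid for \<open>m\<close>, while
      \<open>s\<close> becomes \<open>s[m := x ! m]\<close>.\<close>
    then have "X (take m x @ x ! m # drop (Suc m) s) * X (take m s @ s ! m # drop (Suc m) s) =
        X (take m x @ s ! m # drop (Suc m) s) * X (take m s @ x ! m # drop (Suc m) s)"
      using s s_eq len by (intro swap) auto
    then have "X (take (Suc m) x @ drop (Suc m) s) * X s
        = X (take m x @ drop m s) * X (s[m := x ! m])"
      using len s_eq
      by (simp add: take_Suc_conv_app_nth upd_conv_take_nth_drop Cons_nth_drop_Suc)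
    then show ?case
      using Suc Xs by (simp add: field_simps)
  qed
  \<comment> \<open>The global scalar \<open>X s\<close> is absorbed into factor 0.\<close>
  define a where "a k = vec n (\<lambda>j. (if k = 0 then X s else 1) * (X (s[k := j]) / X s))" for k
  have "X x = outer_product n d a x" for x
  proof (cases "x \<in> multi_indices n d")
    case True
    have "(\<Prod>k<d. a k $ (x ! k)) = (\<Prod>k<d. (if k = 0 then X s else 1) * (X (s[k := x ! k]) / X s))"
      using multi_indices_nth_less[OF True] by (intro prod.cong) (auto simp: a_def)
    also have "\<dots> = X s * (\<Prod>k<d. X (s[k := x ! k]) / X s)"
      unfolding prod.distrib using \<open>d > 0\<close> by simp
    also have "\<dots> = X x"
      using prefix[OF True order.refl] True s by (simp add: multi_indices_def)
    finally show ?thesis using True by (simp add: outer_product_def)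
  next
    case False
    then show ?thesis using X by (simp add: outer_product_def tensors_def)
  qed
  then have "X = outer_product n d a" by blast
  moreover have "\<forall>k<d. a k \<in> carrier_vec n"
    by (simp add: a_def)
  ultimately show ?thesis
    using assms(2) unfolding rank_one_tensor_def by blast
qed

lemma outer_product_append:
  assumes "is \<in> multi_indices n p" "js \<in> multi_indices n q"
  shows "outer_product n (p + q) a (is @ js) =
    (\<Prod>k<p. a k $ (is ! k)) * (\<Prod>k<q. a (p + k) $ (js ! k))"
proof -
  have "(\<Prod>k<p + q. f k) = (\<Prod>k<p. f k) * (\<Prod>k<q. f (p + k))" for f :: "nat \<Rightarrow> real"
    by (induction q) (simp_all add: mult.assoc)
  moreover have "is @ js \<in> multi_indices n (p + q)" "length is = p"
    using assms by (auto simp: multi_indices_def)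
  ultimately show ?thesis
    by (simp add: outer_product_def nth_append)
qed

text \<open>An outer product splits at any cut. For the converse, symmetry brings an arbitrary
  position to the head, where \<open>sym_tensor_swap_head\<close> supplies the exchange that
  \<open>rank_one_tensor_if_swap\<close> asks for.\<close>

lemma rank_one_tensor_iff_splits:
  assumes X: "X \<in> sym_tensors n (p + q)" and "p > 0" "q > 0"
  shows "rank_one_tensor n (p + q) X \<longleftrightarrow>
    (\<exists>u v. \<forall>is\<in>multi_indices n p. \<forall>js\<in>multi_indices n q. X (is @ js) = u is * v js) \<and>
    X \<noteq> (\<lambda>_. 0)"
proof
  assume "rank_one_tensor n (p + q) X"
  then obtain a where "X = outer_product n (p + q) a" "X \<noteq> (\<lambda>_. 0)"
    by (auto simp: rank_one_tensor_def)
  moreover from this have "\<forall>is\<in>multi_indices n p. \<forall>js\<in>multi_indices n q. X (is @ js) =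
      (\<Prod>k<p. a k $ (is ! k)) * (\<Prod>k<q. a (p + k) $ (js ! k))"
    by (simp add: outer_product_append)
  ultimately show "(\<exists>u v. \<forall>is\<in>multi_indices n p. \<forall>js\<in>multi_indices n q. X (is @ js) = u is * v js) \<and>
      X \<noteq> (\<lambda>_. 0)"
    by (intro conjI exI[of _ "\<lambda>is. \<Prod>k<p. a k $ (is ! k)"]
        exI[of _ "\<lambda>js. \<Prod>k<q. a (p + k) $ (js ! k)"])
next
  assume "(\<exists>u v. \<forall>is\<in>multi_indices n p. \<forall>js\<in>multi_indices n q. X (is @ js) = u is * v js) \<and>
      X \<noteq> (\<lambda>_. 0)"
  then obtain u v where uv: "\<And>is js. is \<in> multi_indices n p \<Longrightarrow> js \<in> multi_indices n q \<Longrightarrow>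
      X (is @ js) = u is * v js" and nz: "X \<noteq> (\<lambda>_. 0)"
    by blast
  show "rank_one_tensor n (p + q) X"
  proof (rule rank_one_tensor_if_swap)
    fix x1 a x2 y1 b y2
    assume "x1 @ a # x2 \<in> multi_indices n (p + q)" "y1 @ b # y2 \<in> multi_indices n (p + q)"
    then have "a # (x1 @ x2) \<in> multi_indices n (p + q)" "b # (y1 @ y2) \<in> multi_indices n (p + q)"
      by (auto simp: multi_indices_def)
    then have "X (a # (x1 @ x2)) * X (b # (y1 @ y2)) = X (b # (x1 @ x2)) * X (a # (y1 @ y2))"
      using sym_tensor_swap_head[OF assms uv] by blast
    moreover have "X (z1 @ e # z2) = X (e # (z1 @ z2))" for z1 e z2
      by (rule sym_tensors_mset_cong[OF X]) simp
    ultimately show "X (x1 @ a # x2) * X (y1 @ b # y2) = X (x1 @ b # x2) * X (y1 @ a # y2)"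
      by simp
  qed (use X nz assms in \<open>auto simp: sym_tensors_def\<close>)
qed

theorem theorem2p1:
  fixes d n :: nat
  assumes "d \<ge> 2" and "n \<ge> 1"
  shows "{X. rank_CP n d X = 1 \<and> X \<in> sym_tensors n d}
       = {X. mat_rank (Mat n d X) = 1 \<and> X \<in> sym_tensors n d}"
proof -
  have "rank_CP n d X = 1 \<longleftrightarrow> mat_rank (Mat n d X) = 1" if X: "X \<in> sym_tensors n d" for X
  proof -
    have X': "X \<in> tensors n d"
      using X by (simp add: sym_tensors_def)
    have d: "d div 2 + (d - d div 2) = d"
      by simp
    have "rank_CP n d X = 1 \<longleftrightarrow> rank_one_tensor n d X"
      using rank_CP_eq_1_iff[OF X'] assms(1) by simp
    \<comment> \<open>Both sides equal the splitting condition at \<open>d div 2\<close>;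
      \<open>d >= 2\<close> makes both parts of the cut nonempty.\<close>
    also have "\<dots> \<longleftrightarrow> mat_rank (Mat n d X) = 1"
      using rank_one_tensor_iff_splits[of X n "d div 2" "d - d div 2"]
        Mat_rank_eq_1_iff[OF _ X'] X assms unfolding d by simp
    finally show ?thesis .
  qed
  then show ?thesis by blast
qed

end
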